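(* The following identities hold for all real $\theta$ with $\sin(\theta)\neq 0$: (1) for every integer $n\geq 0$, $$2^{2n}\cos^{2n}(\theta)=\sum_{k=0}^{n}B^{\mathrm{odd}}_{nk}\,\frac{\sin((2k+1)\theta)}{\sin(\theta)};$$ (2) for every integer $n\geq 1$, $$2^{2n-1}\cos^{2n-1}(\theta)=\sum_{k=1}^{n}B^{\mathrm{even}}_{nk}\,\frac{\sin(2k\theta)}{\sin(\theta)}.$$
   Context: The entries of the even and odd Catalan triangles are $B^{\mathrm{even}}_{ij}=\frac{j}{i}\binom{2i}{i-j}$ for integers $i,j\geq 1$ and $B^{\mathrm{odd}}_{ij}=\frac{2j+1}{2i+1}\binom{2i+1}{i-j}$ for integers $i,j\geq 0$, where $\binom{N}{M}=0$ for $M<0$. *)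

theory Defs
  imports Complex_Main
begin

(* The lower argument is an integer so that "i - j" below is a true difference;
   natural-number subtraction would truncate and give 1 instead of 0 for i < j. *)
definition binom_int :: "nat \<Rightarrow> int \<Rightarrow> nat" where
  "binom_int N M = (if M < 0 then 0 else N choose nat M)"

(* Meaningful for i, j \<ge> 1. *)
definition B_even :: "nat \<Rightarrow> nat \<Rightarrow> real" where
  "B_even i j = real j / real i * real (binom_int (2 * i) (int i - int j))"

definition B_odd :: "nat \<Rightarrow> nat \<Rightarrow> real" where
  "B_odd i j = real (2 * j + 1) / real (2 * i + 1) * real (binom_int (2 * i + 1) (int i - int j))"

end

theory Submission
  imports Defs
begin

text \<open>
  The numbers \<open>ballot N m = (N - 2 m) / N * (N choose m)\<close> with \<open>N > 0\<close> obey Pascal's rule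
  (\<open>ballot_Suc_Suc\<close>), and they are the entries of both Catalan triangles: for \<open>j \<le> i\<close>,
  \<open>B_even i j = ballot (2 i) (i - j)\<close> and \<open>B_odd i j = ballot (2 i + 1) (i - j)\<close>.  Hence the
  entries in a row of one triangle are sums of neighbours in a row of the other
  (\<open>B_even_Suc\<close>, \<open>B_odd_eq_B_even\<close>).  Since
  \<open>2 cos \<theta> sin (x \<theta>) = sin ((x + 1) \<theta>) + sin ((x - 1) \<theta>)\<close>, multiplication by \<open>2 cos \<theta>\<close> forms
  the same sums of neighbouring coefficients, and so carries the sine sum of each row to that of
  the next (\<open>two_cos_times_odd_row\<close>, \<open>two_cos_times_even_row\<close>).  Both identities, multiplied by
  \<open>sin \<theta>\<close>, follow by induction from the trivial case of exponent \<open>0\<close>, alternating between the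
  two triangles.
\<close>

text \<open>The common form of the entries of the two triangles.  For \<open>0 < N\<close> and \<open>2 m \<le> N\<close> it is the
  number of orders of counting \<open>N\<close> votes, \<open>m\<close> of them for the loser, in which the winner is
  always strictly ahead.\<close>
definition ballot :: "nat \<Rightarrow> nat \<Rightarrow> real" where
  "ballot N m = (real N - 2 * real m) / real N * real (N choose m)"

lemma ballot_Suc_Suc:
  assumes "N > 0"
  shows "ballot (Suc N) (Suc m) = ballot N m + ballot N (Suc m)"
proof -
  define a b where "a = real (N choose m)" and "b = real (N choose Suc m)"
  have ab: "(real m + 1) * b = (real N - real m) * a"
  proof (cases "m \<le> N")
    case True
    have "Suc m * (N choose Suc m) = (N - m) * (N choose m)"
      by (metis binomial_absorb_comp binomial_absorption)
    then have "real (Suc m * (N choose Suc m)) = real ((N - m) * (N choose m))"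
      by simp
    then show ?thesis
      using True by (simp add: a_def b_def of_nat_diff algebra_simps)
  qed (simp add: a_def b_def binomial_eq_0)
  have "(real N - 2 * real m - 1) * (a + b) * real N
      = ((real N - 2 * real m) * a + (real N - 2 * real m - 2) * b) * (real N + 1)"
    using ab by algebra
  then have "(real N - 2 * real m - 1) * (a + b) / (real N + 1)
      = ((real N - 2 * real m) * a + (real N - 2 * real m - 2) * b) / real N"
    using assms by (subst frac_eq_eq) simp_all
  then have "(real N - 2 * real m - 1) / (real N + 1) * (a + b)
      = (real N - 2 * real m) / real N * a + (real N - 2 * real m - 2) / real N * b"
    by (simp add: add_divide_distrib)
  then show ?thesis
    by (simp add: ballot_def a_def b_def algebra_simps)
qed

lemma B_even_eq_ballot: "j \<le> i \<Longrightarrow> B_even i j = ballot (2 * i) (i - j)"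
  by (simp add: B_even_def binom_int_def ballot_def of_nat_diff nat_diff_distrib)

lemma B_odd_eq_ballot: "j \<le> i \<Longrightarrow> B_odd i j = ballot (2 * i + 1) (i - j)"
  by (simp add: B_odd_def binom_int_def ballot_def of_nat_diff nat_diff_distrib)

lemma B_even_eq_0: "i < j \<Longrightarrow> B_even i j = 0"
  by (simp add: B_even_def binom_int_def)

lemma B_odd_eq_0: "i < j \<Longrightarrow> B_odd i j = 0"
  by (simp add: B_odd_def binom_int_def)

lemma B_even_0_right: "B_even i 0 = 0"
  by (simp add: B_even_def)

lemma ballot_0_right: "N > 0 \<Longrightarrow> ballot N 0 = 1"
  by (simp add: ballot_def)

lemma B_odd_eq_B_even:
  assumes "i > 0"
  shows "B_odd i j = B_even i j + B_even i (Suc j)"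
proof -
  consider "i < j" | "i = j" | "j < i" by linarith
  then show ?thesis
  proof cases
    case 3
    then have "i - j = Suc (i - Suc j)" by simp
    then show ?thesis
      using 3 assms ballot_Suc_Suc[of "2 * i" "i - Suc j"]
      by (simp add: B_odd_eq_ballot B_even_eq_ballot)
  qed (use assms in \<open>simp_all add: B_odd_eq_0 B_even_eq_0 B_odd_eq_ballot B_even_eq_ballot
      ballot_0_right\<close>)
qed

lemma B_even_Suc: "B_even (Suc i) (Suc j) = B_odd i j + B_odd i (Suc j)"
proof -
  consider "i < j" | "i = j" | "j < i" by linarith
  then show ?thesis
  proof cases
    case 3
    then have "i - j = Suc (i - Suc j)" by simp
    then show ?thesis
      using 3 ballot_Suc_Suc[of "2 * i + 1" "i - Suc j"]
      by (simp add: B_odd_eq_ballot B_even_eq_ballot)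
  qed (simp_all add: B_odd_eq_0 B_even_eq_0 B_odd_eq_ballot B_even_eq_ballot ballot_0_right)
qed

lemma two_cos_times_sin:
  fixes x \<theta> :: real
  shows "2 * cos \<theta> * sin (x * \<theta>) = sin ((x + 1) * \<theta>) + sin ((x - 1) * \<theta>)"
  by (simp add: sin_add sin_diff algebra_simps)

lemma sum_neighbours:
  fixes b s :: "nat \<Rightarrow> real"
  assumes "b (Suc n) = 0"
  shows "(\<Sum>k\<le>n. b k * (s (Suc k) + s k)) = b 0 * s 0 + (\<Sum>k\<le>n. (b k + b (Suc k)) * s (Suc k))"
proof -
  have "(\<Sum>k\<le>n. b k * s k) = (\<Sum>k\<le>Suc n. b k * s k)"
    using assms by simp
  also have "\<dots> = b 0 * s 0 + (\<Sum>k\<le>n. b (Suc k) * s (Suc k))"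
    by (rule sum.atMost_Suc_shift)
  finally show ?thesis
    by (simp add: sum.distrib algebra_simps)
qed

lemma two_cos_times_odd_row:
  fixes \<theta> :: real
  shows "2 * cos \<theta> * (\<Sum>k\<le>n. B_odd n k * sin (real (2 * k + 1) * \<theta>))
       = (\<Sum>k\<le>n. B_even (Suc n) (Suc k) * sin (real (2 * Suc k) * \<theta>))"
proof -
  have "2 * cos \<theta> * (\<Sum>k\<le>n. B_odd n k * sin (real (2 * k + 1) * \<theta>))
      = (\<Sum>k\<le>n. B_odd n k * (2 * cos \<theta> * sin (real (2 * k + 1) * \<theta>)))"
    by (simp add: sum_distrib_left mult_ac)
  also have "\<dots> = (\<Sum>k\<le>n. B_odd n k * (sin (real (2 * Suc k) * \<theta>) + sin (real (2 * k) * \<theta>)))"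
    by (simp add: two_cos_times_sin add_ac)
  also have "\<dots> = (\<Sum>k\<le>n. B_even (Suc n) (Suc k) * sin (real (2 * Suc k) * \<theta>))"
    by (subst sum_neighbours[where s = "\<lambda>k. sin (real (2 * k) * \<theta>)"])
      (simp_all add: B_odd_eq_0 B_even_Suc)
  finally show ?thesis .
qed

lemma two_cos_times_even_row:
  fixes \<theta> :: real
  assumes "n > 0"
  shows "2 * cos \<theta> * (\<Sum>k\<le>n. B_even n k * sin (real (2 * k) * \<theta>))
       = (\<Sum>k\<le>n. B_odd n k * sin (real (2 * k + 1) * \<theta>))"
proof -
  \<comment> \<open>The sine attached to \<open>k\<close> has frequency \<open>2 k - 1\<close>, which is \<open>-1\<close> at \<open>k = 0\<close>; that term
      is killed by \<open>B_even n 0 = 0\<close>.\<close>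
  define s where "s k = sin ((2 * real k - 1) * \<theta>)" for k
  have "2 * cos \<theta> * (\<Sum>k\<le>n. B_even n k * sin (real (2 * k) * \<theta>))
      = (\<Sum>k\<le>n. B_even n k * (2 * cos \<theta> * sin (real (2 * k) * \<theta>)))"
    by (simp add: sum_distrib_left mult_ac)
  also have "\<dots> = (\<Sum>k\<le>n. B_even n k * (s (Suc k) + s k))"
    by (simp add: two_cos_times_sin s_def add_ac)
  also have "\<dots> = (\<Sum>k\<le>n. B_odd n k * s (Suc k))"
    using assms by (subst sum_neighbours)
      (simp_all add: B_even_eq_0 B_even_0_right B_odd_eq_B_even)
  finally show ?thesis
    by (simp add: s_def add_ac)
qed

lemma sum_B_even_shift:
  "(\<Sum>k\<le>Suc n. B_even (Suc n) k * g k) = (\<Sum>k\<le>n. B_even (Suc n) (Suc k) * g (Suc k))"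
  by (subst sum.atMost_Suc_shift) (simp add: B_even_0_right)

lemma even_power_two_cos_times_sin:
  fixes \<theta> :: real
  shows "(2 * cos \<theta>) ^ (2 * n) * sin \<theta> = (\<Sum>k\<le>n. B_odd n k * sin (real (2 * k + 1) * \<theta>))"
proof (induction n)
  case 0
  show ?case by (simp add: B_odd_def binom_int_def)
next
  case (Suc n)
  have "(2 * cos \<theta>) ^ (2 * Suc n) * sin \<theta>
      = 2 * cos \<theta> * (2 * cos \<theta> * ((2 * cos \<theta>) ^ (2 * n) * sin \<theta>))"
    by (simp add: mult_ac)
  also have "\<dots> = 2 * cos \<theta> * (\<Sum>k\<le>Suc n. B_even (Suc n) k * sin (real (2 * k) * \<theta>))"
    unfolding Suc.IH two_cos_times_odd_row sum_B_even_shift ..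
  also have "\<dots> = (\<Sum>k\<le>Suc n. B_odd (Suc n) k * sin (real (2 * k + 1) * \<theta>))"
    by (rule two_cos_times_even_row) simp
  finally show ?case .
qed

lemma odd_power_two_cos_times_sin:
  fixes \<theta> :: real
  assumes "n \<ge> 1"
  shows "(2 * cos \<theta>) ^ (2 * n - 1) * sin \<theta> = (\<Sum>k = 1..n. B_even n k * sin (real (2 * k) * \<theta>))"
proof -
  obtain m where n: "n = Suc m"
    using assms by (cases n) auto
  have "(2 * cos \<theta>) ^ (2 * n - 1) * sin \<theta> = 2 * cos \<theta> * ((2 * cos \<theta>) ^ (2 * m) * sin \<theta>)"
    by (simp add: n mult_ac)
  also have "\<dots> = (\<Sum>k\<le>m. B_even n (Suc k) * sin (real (2 * Suc k) * \<theta>))"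
    unfolding even_power_two_cos_times_sin two_cos_times_odd_row n ..
  also have "\<dots> = (\<Sum>k = 1..n. B_even n k * sin (real (2 * k) * \<theta>))"
    unfolding n One_nat_def by (subst sum.atLeast_Suc_atMost_Suc_shift) (simp add: atMost_atLeast0)
  finally show ?thesis .
qed

theorem corollary7p2:
  fixes \<theta> :: real
  assumes "sin \<theta> \<noteq> 0"
  shows "(\<forall>n::nat. 2 ^ (2 * n) * cos \<theta> ^ (2 * n)
            = (\<Sum>k = 0..n. B_odd n k * (sin (real (2 * k + 1) * \<theta>) / sin \<theta>)))
       \<and> (\<forall>n::nat. n \<ge> 1 \<longrightarrow> 2 ^ (2 * n - 1) * cos \<theta> ^ (2 * n - 1)
            = (\<Sum>k = 1..n. B_even n k * (sin (real (2 * k) * \<theta>) / sin \<theta>)))"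
proof (intro conjI allI impI)
  fix n :: nat
  have "2 ^ (2 * n) * cos \<theta> ^ (2 * n) = (2 * cos \<theta>) ^ (2 * n) * sin \<theta> / sin \<theta>"
    by (simp only: power_mult_distrib nonzero_mult_div_cancel_right[OF assms])
  also have "\<dots> = (\<Sum>k = 0..n. B_odd n k * (sin (real (2 * k + 1) * \<theta>) / sin \<theta>))"
    unfolding even_power_two_cos_times_sin
    by (simp only: sum_divide_distrib times_divide_eq_right atMost_atLeast0)
  finally show "2 ^ (2 * n) * cos \<theta> ^ (2 * n)
      = (\<Sum>k = 0..n. B_odd n k * (sin (real (2 * k + 1) * \<theta>) / sin \<theta>))" .
next
  fix n :: nat
  assume "n \<ge> 1"
  have "2 ^ (2 * n - 1) * cos \<theta> ^ (2 * n - 1) = (2 * cos \<theta>) ^ (2 * n - 1) * sin \<theta> / sin \<theta>"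
    by (simp only: power_mult_distrib nonzero_mult_div_cancel_right[OF assms])
  also have "\<dots> = (\<Sum>k = 1..n. B_even n k * (sin (real (2 * k) * \<theta>) / sin \<theta>))"
    unfolding odd_power_two_cos_times_sin[OF \<open>n \<ge> 1\<close>]
    by (simp only: sum_divide_distrib times_divide_eq_right)
  finally show "2 ^ (2 * n - 1) * cos \<theta> ^ (2 * n - 1)
      = (\<Sum>k = 1..n. B_even n k * (sin (real (2 * k) * \<theta>) / sin \<theta>))" .
qed

end
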